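(* Let $\mathcal{T}$ be a closed PDL-tableau. Then for every node $t$ of $\mathcal{T}$, the sequent $\Lambda(t)$ labelling $t$ is unsatisfiable (where marks on loaded programs are ignored semantically).
   Context: PDL syntax: $\phi ::= \bot \mid p \mid \lnot\phi \mid \phi\land\phi \mid [\alpha]\phi$, $\alpha ::= a \mid \tau? \mid \alpha\cup\beta \mid \alpha;\beta \mid \alpha^\ast$ ($a$ atomic programs), with standard Kripke semantics. For a list $\bar\delta=\delta_1\cdots\delta_n$ of programs, $\Box(\bar\delta,\phi)=[\delta_1]\cdots[\delta_n]\phi$ ($=\phi$ if $\bar\delta=\varepsilon$); juxtaposition is concatenation. Unfolding boxes: $\mathit{Tests}(a)=\emptyset$, $\mathit{Tests}(\tau?)=\{\tau\}$, $\mathit{Tests}(\alpha\cup\beta)=\mathit{Tests}(\alpha;\beta)=\mathit{Tests}(\alpha)\cup\mathit{Tests}(\beta)$, $\mathit{Tests}(\alpha^\ast)=\mathit{Tests}(\alpha)$. For a set $\ell$ of formulas: $P^\ell(a)=\{a\}$; $P^\ell(\tau?)=\{\varepsilon\}$ if $\tau\in\ell$, else $\emptyset$; $P^\ell(\beta\cup\gamma)=P^\ell(\beta)\cup P^\ell(\gamma)$; $P^\ell(\beta;\gamma)=\{\bar\beta\gamma\mid\bar\beta\in P^\ell(\beta)\setminus\{\varepsilon\}\}\cup\{\bar\gamma\mid\bar\gamma\in P^\ell(\gamma),\varepsilon\in P^\ell(\beta)\}$; $P^\ell(\beta^\ast)=\{\varepsilon\}\cup\{\bar\beta\beta^\ast\mid\bar\beta\in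 P^\ell(\beta)\setminus\{\varepsilon\}\}$. $F^\ell(\alpha)=\{\lnot\tau\mid\tau\in\mathit{Tests}(\alpha),\tau\notin\ell\}$, $X^\ell_{\alpha,\psi}=F^\ell(\alpha)\cup\{\Box(\bar\alpha,\psi)\mid\bar\alpha\in P^\ell(\alpha)\}$, $\mathsf{unfold}_\Box(\alpha,\psi)=\{X^\ell_{\alpha,\psi}\mid\ell\subseteq\mathit{Tests}(\alpha)\}$. Unfolding diamonds: $H_a=\{(\emptyset,a)\}$, $H_{\tau?}=\{(\{\tau\},\varepsilon)\}$, $H_{\alpha\cup\beta}=H_\alpha\cup H_\beta$, $H_{\alpha;\beta}=\{(X,\bar\delta\beta)\mid(X,\bar\delta)\in H_\alpha,\bar\delta\neq\varepsilon\}\cup\{(X\cup Y,\bar\delta)\mid(X,\varepsilon)\in H_\alpha,(Y,\bar\delta)\in H_\beta\}$, $H_{\alpha^\ast}=\{(\emptyset,\varepsilon)\}\cup\{(X,\bar\delta\alpha^\ast)\mid(X,\bar\delta)\in H_\alpha,\bar\delta\neq\varepsilon\}$; $\mathsf{unfold}_\Diamond(\alpha,\psi)=\{X\cup\{\lnot\Box(\bar\delta,\psi)\}\mid(X,\bar\delta)\in H_\alpha\}$. Loading: each program $\alpha$ has a marked copy $\underline\alpha$ (semantically identical). A loaded formula has the form $\lnot[\underline{\alpha_1}]\cdots[\underline{\alpha_n}]\phi$, $n\ge1$, $\phi$ an unmarked PDL formula; $\xi$ ranges over PDL formulas and expressions $[\underline{\alpha_1}]\cdots[\underline{\alpha_k}]\phi$,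 $k\ge1$. $\underline\Box(\bar\delta,\xi)=[\underline{\delta_1}]\cdots[\underline{\delta_n}]\xi$, $\underline{\mathsf{unfold}}_\Diamond(\alpha,\xi)=\{X\cup\{\lnot\underline\Box(\bar\delta,\xi)\}\mid(X,\bar\delta)\in H_\alpha\}$. A sequent (finite set of possibly loaded formulas) is loaded if it contains a loaded formula, else free; it is basic if all its formulas have the form $\bot,\lnot\bot,p,\lnot p,[a]\phi,\lnot[a]\phi$ ($a$ atomic). $\Delta_a=\{\phi\mid[a]\phi\in\Delta\}$. Rules (principal formula not in context $\Delta$): $(\lnot)$ $\Delta,\lnot\lnot\phi/\Delta,\phi$; $(\land)$ $\Delta,\phi\land\psi/\Delta,\phi,\psi$; $(\lnot\land)$ $\Delta,\lnot(\phi\land\psi)/\Delta,\lnot\phi\mid\Delta,\lnot\psi$; $(\Box)$ $\Delta,[\alpha]\phi/\{\Delta\cup\Gamma\mid\Gamma\in\mathsf{unfold}_\Box(\alpha,\phi)\}$, $\alpha$ non-atomic; $(\Diamond)$ $\Delta,\lnot[\alpha]\phi/\{\Delta\cup\Gamma\mid\Gamma\in\mathsf{unfold}_\Diamond(\alpha,\phi)\}$, $\alpha$ non-atomic; $(\underline\Diamond)$ $\Delta,\lnot[\underline\alpha]\xi/\{\Delta\cup\Gamma\mid\Gamma\in\underline{\mathsf{unfold}}_\Diamond(\alpha,\xi)\}$, $\alpha$ non-atomic; $(L+)$ $\Delta,\lnot[a][\alpha_1]\cdots[\alpha_n]\phi/\Delta,\lnot[\underline a][\underline{\alpha_1}]\cdots[\underline{\alpha_n}]\phi$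 with $\Delta$ free and basic, $n\ge0$ maximal; $(L-)$ $\Delta,\lnot[\underline{\alpha_1}]\cdots[\underline{\alpha_n}]\phi/\Delta,\lnot[\alpha_1]\cdots[\alpha_n]\phi$ with $\Delta$ basic, $n\ge1$; modal rule $(M)$ $\Delta,\lnot[\underline a]\xi/\Delta_a,\lnot\xi$ with $\Delta$ basic. $(L-)$ may not be applied to a node produced by $(L+)$. A tableau is a rooted tree labelled by sequents in which each interior node with its children is a rule instance. A repeat is a node whose label equals that of a proper ancestor (nearest such: its companion); it is a loaded-path repeat if all nodes from companion to it are loaded, a free repeat if it is free. A PDL-tableau is a tableau in which all loaded-path repeats and all free repeats are leaves. A node is closed if its label contains $\bot$ or some $\phi$ and $\lnot\phi$; a PDL-tableau is closed if every leaf is closed or a loaded-path repeat. *)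

theory Defs
  imports Main "HOL-Library.Sublist"
begin

datatype ('p, 'a) fml =
    Bot
  | Prop 'p
  | Neg "('p, 'a) fml"
  | Conj "('p, 'a) fml" "('p, 'a) fml"
  | Box "('p, 'a) prog" "('p, 'a) fml"
and ('p, 'a) prog =
    Atom 'a
  | Test "('p, 'a) fml"
  | Choice "('p, 'a) prog" "('p, 'a) prog"
  | Seq "('p, 'a) prog" "('p, 'a) prog"
  | Star "('p, 'a) prog"

text \<open>The set of states of a Kripke model is the whole of the type \<open>'w\<close>.\<close>

record ('w, 'p, 'a) kripke =
  rel :: "'a \<Rightarrow> ('w \<times> 'w) set"
  val :: "'p \<Rightarrow> 'w set"

primrec sat :: "('w, 'p, 'a) kripke \<Rightarrow> ('p, 'a) fml \<Rightarrow> 'w \<Rightarrow> bool"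
  and prog_rel :: "('w, 'p, 'a) kripke \<Rightarrow> ('p, 'a) prog \<Rightarrow> ('w \<times> 'w) set" where
  "sat M Bot = (\<lambda>w. False)"
| "sat M (Prop p) = (\<lambda>w. w \<in> val M p)"
| "sat M (Neg \<phi>) = (\<lambda>w. \<not> sat M \<phi> w)"
| "sat M (Conj \<phi> \<psi>) = (\<lambda>w. sat M \<phi> w \<and> sat M \<psi> w)"
| "sat M (Box \<alpha> \<phi>) = (\<lambda>w. \<forall>v. (w, v) \<in> prog_rel M \<alpha> \<longrightarrow> sat M \<phi> v)"
| "prog_rel M (Atom a) = rel M a"
| "prog_rel M (Test \<tau>) = {(w, w) |w. sat M \<tau> w}"
| "prog_rel M (Choice \<alpha> \<beta>) = prog_rel M \<alpha> \<union> prog_rel M \<beta>"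
| "prog_rel M (Seq \<alpha> \<beta>) = prog_rel M \<alpha> O prog_rel M \<beta>"
| "prog_rel M (Star \<alpha>) = (prog_rel M \<alpha>)\<^sup>*"

definition is_atomic :: "('p, 'a) prog \<Rightarrow> bool" where
  "is_atomic \<alpha> \<longleftrightarrow> (\<exists>a. \<alpha> = Atom a)"

definition boxes :: "('p, 'a) prog list \<Rightarrow> ('p, 'a) fml \<Rightarrow> ('p, 'a) fml" where
  "boxes \<delta>s \<phi> = foldr Box \<delta>s \<phi>"

subsection \<open>Unfolding boxes\<close>

fun Tests :: "('p, 'a) prog \<Rightarrow> ('p, 'a) fml set" where
  "Tests (Atom a) = {}"
| "Tests (Test \<tau>) = {\<tau>}"
| "Tests (Choice \<alpha> \<beta>) = Tests \<alpha> \<union> Tests \<beta>"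
| "Tests (Seq \<alpha> \<beta>) = Tests \<alpha> \<union> Tests \<beta>"
| "Tests (Star \<alpha>) = Tests \<alpha>"

fun Pset :: "('p, 'a) fml set \<Rightarrow> ('p, 'a) prog \<Rightarrow> ('p, 'a) prog list set" where
  "Pset l (Atom a) = {[Atom a]}"
| "Pset l (Test \<tau>) = (if \<tau> \<in> l then {[]} else {})"
| "Pset l (Choice \<beta> \<gamma>) = Pset l \<beta> \<union> Pset l \<gamma>"
| "Pset l (Seq \<beta> \<gamma>) =
     {\<beta>s @ [\<gamma>] |\<beta>s. \<beta>s \<in> Pset l \<beta> - {[]}} \<union> {\<gamma>s. \<gamma>s \<in> Pset l \<gamma> \<and> [] \<in> Pset l \<beta>}"
| "Pset l (Star \<beta>) = {[]} \<union> {\<beta>s @ [Star \<beta>] |\<beta>s. \<beta>s \<in> Pset l \<beta> - {[]}}"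

definition Fset :: "('p, 'a) fml set \<Rightarrow> ('p, 'a) prog \<Rightarrow> ('p, 'a) fml set" where
  "Fset l \<alpha> = {Neg \<tau> |\<tau>. \<tau> \<in> Tests \<alpha> \<and> \<tau> \<notin> l}"

definition Xset ::
  "('p, 'a) fml set \<Rightarrow> ('p, 'a) prog \<Rightarrow> ('p, 'a) fml \<Rightarrow> ('p, 'a) fml set" where
  "Xset l \<alpha> \<psi> = Fset l \<alpha> \<union> {boxes \<alpha>s \<psi> |\<alpha>s. \<alpha>s \<in> Pset l \<alpha>}"

definition unfold_box ::
  "('p, 'a) prog \<Rightarrow> ('p, 'a) fml \<Rightarrow> ('p, 'a) fml set set" where
  "unfold_box \<alpha> \<psi> = {Xset l \<alpha> \<psi> |l. l \<subseteq> Tests \<alpha>}"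

subsection \<open>Unfolding diamonds\<close>

fun Hset :: "('p, 'a) prog \<Rightarrow> (('p, 'a) fml set \<times> ('p, 'a) prog list) set" where
  "Hset (Atom a) = {({}, [Atom a])}"
| "Hset (Test \<tau>) = {({\<tau>}, [])}"
| "Hset (Choice \<alpha> \<beta>) = Hset \<alpha> \<union> Hset \<beta>"
| "Hset (Seq \<alpha> \<beta>) =
     {(Y, \<delta>s @ [\<beta>]) |Y \<delta>s. (Y, \<delta>s) \<in> Hset \<alpha> \<and> \<delta>s \<noteq> []} \<union>
     {(Y \<union> Z, \<delta>s) |Y Z \<delta>s. (Y, []) \<in> Hset \<alpha> \<and> (Z, \<delta>s) \<in> Hset \<beta>}"
| "Hset (Star \<alpha>) =
     {({}, [])} \<union> {(Y, \<delta>s @ [Star \<alpha>]) |Y \<delta>s. (Y, \<delta>s) \<in> Hset \<alpha> \<and> \<delta>s \<noteq> []}"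

definition unfold_dia ::
  "('p, 'a) prog \<Rightarrow> ('p, 'a) fml \<Rightarrow> ('p, 'a) fml set set" where
  "unfold_dia \<alpha> \<psi> = {Y \<union> {Neg (boxes \<delta>s \<psi>)} |Y \<delta>s. (Y, \<delta>s) \<in> Hset \<alpha>}"

subsection \<open>Loaded formulas and sequents\<close>

text \<open>
  \<open>xi\<close> is the range of the metavariable \<open>\<xi>\<close>: a plain formula below a (possibly empty)
  block of boxes with marked programs, \<open>LBox\<close> being the marked box.  Since marks only
  occur in such a block below a negation, the elements of a sequent are plain formulas
  \<open>Fml \<phi>\<close> and loaded formulas \<open>NegLBox \<alpha> \<xi>\<close>, the latter standing for the negation of the
  marked box of \<open>\<alpha>\<close> over \<open>\<xi>\<close>.
\<close>

datatype ('p, 'a) xi = Plain "('p, 'a) fml" | LBox "('p, 'a) prog" "('p, 'a) xi"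

datatype ('p, 'a) sfml = Fml "('p, 'a) fml" | NegLBox "('p, 'a) prog" "('p, 'a) xi"

type_synonym ('p, 'a) sequent = "('p, 'a) sfml set"

fun neg_xi :: "('p, 'a) xi \<Rightarrow> ('p, 'a) sfml" where
  "neg_xi (Plain \<phi>) = Fml (Neg \<phi>)"
| "neg_xi (LBox \<alpha> \<xi>) = NegLBox \<alpha> \<xi>"

definition lboxes :: "('p, 'a) prog list \<Rightarrow> ('p, 'a) xi \<Rightarrow> ('p, 'a) xi" where
  "lboxes \<delta>s \<xi> = foldr LBox \<delta>s \<xi>"

fun unmark_xi :: "('p, 'a) xi \<Rightarrow> ('p, 'a) fml" where
  "unmark_xi (Plain \<phi>) = \<phi>"
| "unmark_xi (LBox \<alpha> \<xi>) = Box \<alpha> (unmark_xi \<xi>)"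

fun unmark :: "('p, 'a) sfml \<Rightarrow> ('p, 'a) fml" where
  "unmark (Fml \<phi>) = \<phi>"
| "unmark (NegLBox \<alpha> \<xi>) = Neg (Box \<alpha> (unmark_xi \<xi>))"

definition sat_sequent ::
  "('w, 'p, 'a) kripke \<Rightarrow> 'w \<Rightarrow> ('p, 'a) sequent \<Rightarrow> bool" where
  "sat_sequent M w \<Gamma> \<longleftrightarrow> (\<forall>x\<in>\<Gamma>. sat M (unmark x) w)"

definition unfold_ldia ::
  "('p, 'a) prog \<Rightarrow> ('p, 'a) xi \<Rightarrow> ('p, 'a) sequent set" where
  "unfold_ldia \<alpha> \<xi> = {Fml ` Y \<union> {neg_xi (lboxes \<delta>s \<xi>)} |Y \<delta>s. (Y, \<delta>s) \<in> Hset \<alpha>}"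

definition loaded :: "('p, 'a) sequent \<Rightarrow> bool" where
  "loaded \<Gamma> \<longleftrightarrow> (\<exists>\<alpha> \<xi>. NegLBox \<alpha> \<xi> \<in> \<Gamma>)"

abbreviation free :: "('p, 'a) sequent \<Rightarrow> bool" where
  "free \<Gamma> \<equiv> \<not> loaded \<Gamma>"

inductive basic_sfml :: "('p, 'a) sfml \<Rightarrow> bool" where
  "basic_sfml (Fml Bot)"
| "basic_sfml (Fml (Neg Bot))"
| "basic_sfml (Fml (Prop p))"
| "basic_sfml (Fml (Neg (Prop p)))"
| "basic_sfml (Fml (Box (Atom a) \<phi>))"
| "basic_sfml (Fml (Neg (Box (Atom a) \<phi>)))"
| "basic_sfml (NegLBox (Atom a) \<xi>)"

definition basic :: "('p, 'a) sequent \<Rightarrow> bool" where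
  "basic \<Gamma> \<longleftrightarrow> (\<forall>x\<in>\<Gamma>. basic_sfml x)"

definition proj :: "'a \<Rightarrow> ('p, 'a) sequent \<Rightarrow> ('p, 'a) sequent" where
  "proj a \<Delta> = {Fml \<phi> |\<phi>. Fml (Box (Atom a) \<phi>) \<in> \<Delta>}"

definition closed_sequent :: "('p, 'a) sequent \<Rightarrow> bool" where
  "closed_sequent \<Gamma> \<longleftrightarrow> Fml Bot \<in> \<Gamma> \<or> (\<exists>\<phi>. Fml \<phi> \<in> \<Gamma> \<and> Fml (Neg \<phi>) \<in> \<Gamma>)"

subsection \<open>Rules\<close>

datatype rule = RNeg | RConj | RNegConj | RBox | RDia | RLDia | RLPlus | RLMinus | RM

text \<open>
  \<open>rule_inst r \<Gamma> C\<close>: the sequent \<open>\<Gamma>\<close> and the set \<open>C\<close> of the sequents below the line form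
  an instance of rule \<open>r\<close>.  In \<open>lplus\<close>, the maximality of the block of boxes that gets
  marked is expressed by \<open>\<phi>\<close> not being a box formula; in \<open>lminus\<close>, the block consists of
  all the marked boxes, because a loaded formula is unmarked below it.
\<close>

inductive rule_inst ::
  "rule \<Rightarrow> ('p, 'a) sequent \<Rightarrow> ('p, 'a) sequent set \<Rightarrow> bool" where
  neg: "Fml (Neg (Neg \<phi>)) \<notin> \<Delta> \<Longrightarrow>
    rule_inst RNeg (insert (Fml (Neg (Neg \<phi>))) \<Delta>) {insert (Fml \<phi>) \<Delta>}"
| conj: "Fml (Conj \<phi> \<psi>) \<notin> \<Delta> \<Longrightarrow>
    rule_inst RConj (insert (Fml (Conj \<phi> \<psi>)) \<Delta>) {insert (Fml \<phi>) (insert (Fml \<psi>) \<Delta>)}"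
| neg_conj: "Fml (Neg (Conj \<phi> \<psi>)) \<notin> \<Delta> \<Longrightarrow>
    rule_inst RNegConj (insert (Fml (Neg (Conj \<phi> \<psi>))) \<Delta>)
      {insert (Fml (Neg \<phi>)) \<Delta>, insert (Fml (Neg \<psi>)) \<Delta>}"
| box: "Fml (Box \<alpha> \<phi>) \<notin> \<Delta> \<Longrightarrow> \<not> is_atomic \<alpha> \<Longrightarrow>
    rule_inst RBox (insert (Fml (Box \<alpha> \<phi>)) \<Delta>) {\<Delta> \<union> Fml ` \<Gamma> |\<Gamma>. \<Gamma> \<in> unfold_box \<alpha> \<phi>}"
| dia: "Fml (Neg (Box \<alpha> \<phi>)) \<notin> \<Delta> \<Longrightarrow> \<not> is_atomic \<alpha> \<Longrightarrow>
    rule_inst RDia (insert (Fml (Neg (Box \<alpha> \<phi>))) \<Delta>)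
      {\<Delta> \<union> Fml ` \<Gamma> |\<Gamma>. \<Gamma> \<in> unfold_dia \<alpha> \<phi>}"
| ldia: "NegLBox \<alpha> \<xi> \<notin> \<Delta> \<Longrightarrow> \<not> is_atomic \<alpha> \<Longrightarrow>
    rule_inst RLDia (insert (NegLBox \<alpha> \<xi>) \<Delta>) {\<Delta> \<union> \<Gamma> |\<Gamma>. \<Gamma> \<in> unfold_ldia \<alpha> \<xi>}"
| lplus: "Fml (Neg (boxes (Atom a # \<alpha>s) \<phi>)) \<notin> \<Delta> \<Longrightarrow> free \<Delta> \<Longrightarrow> basic \<Delta> \<Longrightarrow>
    (\<nexists>\<beta> \<psi>. \<phi> = Box \<beta> \<psi>) \<Longrightarrow>
    rule_inst RLPlus (insert (Fml (Neg (boxes (Atom a # \<alpha>s) \<phi>))) \<Delta>)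
      {insert (neg_xi (lboxes (Atom a # \<alpha>s) (Plain \<phi>))) \<Delta>}"
| lminus: "neg_xi (lboxes \<alpha>s (Plain \<phi>)) \<notin> \<Delta> \<Longrightarrow> \<alpha>s \<noteq> [] \<Longrightarrow> basic \<Delta> \<Longrightarrow>
    rule_inst RLMinus (insert (neg_xi (lboxes \<alpha>s (Plain \<phi>))) \<Delta>)
      {insert (Fml (Neg (boxes \<alpha>s \<phi>))) \<Delta>}"
| modal: "NegLBox (Atom a) \<xi> \<notin> \<Delta> \<Longrightarrow> basic \<Delta> \<Longrightarrow>
    rule_inst RM (insert (NegLBox (Atom a) \<xi>) \<Delta>) {insert (neg_xi \<xi>) (proj a \<Delta>)}"

subsection \<open>Tableaux\<close>

text \<open>
  A rooted tree is a prefix-closed set of positions containing the root position \<open>[]\<close>; the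
  children of \<open>t\<close> are the nodes \<open>t @ [i]\<close>, its proper ancestors the strict prefixes of \<open>t\<close>.
  Trees may be infinite.  \<open>rule_at\<close> records which rule is applied at an interior node; it is
  irrelevant at leaves.
\<close>

record ('p, 'a) tableau =
  nodes :: "nat list set"
  label :: "nat list \<Rightarrow> ('p, 'a) sequent"
  rule_at :: "nat list \<Rightarrow> rule"

definition children :: "('p, 'a) tableau \<Rightarrow> nat list \<Rightarrow> nat list set" where
  "children T t = {t @ [i] |i. t @ [i] \<in> nodes T}"

definition leaf :: "('p, 'a) tableau \<Rightarrow> nat list \<Rightarrow> bool" where
  "leaf T t \<longleftrightarrow> t \<in> nodes T \<and> children T t = {}"

definition interior :: "('p, 'a) tableau \<Rightarrow> nat list \<Rightarrow> bool" where
  "interior T t \<longleftrightarrow> t \<in> nodes T \<and> children T t \<noteq> {}"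

definition is_tableau :: "('p, 'a) tableau \<Rightarrow> bool" where
  "is_tableau T \<longleftrightarrow>
     [] \<in> nodes T \<and>
     (\<forall>t i. t @ [i] \<in> nodes T \<longrightarrow> t \<in> nodes T) \<and>
     (\<forall>t\<in>nodes T. finite (label T t)) \<and>
     (\<forall>t. interior T t \<longrightarrow> rule_inst (rule_at T t) (label T t) (label T ` children T t)) \<and>
     (\<forall>t s. interior T t \<and> s \<in> children T t \<and> interior T s \<and> rule_at T t = RLPlus
        \<longrightarrow> rule_at T s \<noteq> RLMinus)"

definition repeat :: "('p, 'a) tableau \<Rightarrow> nat list \<Rightarrow> bool" where
  "repeat T t \<longleftrightarrow> t \<in> nodes T \<and> (\<exists>s. strict_prefix s t \<and> label T s = label T t)"

definition companion :: "('p, 'a) tableau \<Rightarrow> nat list \<Rightarrow> nat list \<Rightarrow> bool" where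
  "companion T c t \<longleftrightarrow> strict_prefix c t \<and> label T c = label T t \<and>
     (\<forall>s. strict_prefix s t \<and> label T s = label T t \<longrightarrow> prefix s c)"

definition loaded_path_repeat :: "('p, 'a) tableau \<Rightarrow> nat list \<Rightarrow> bool" where
  "loaded_path_repeat T t \<longleftrightarrow> repeat T t \<and>
     (\<exists>c. companion T c t \<and> (\<forall>s. prefix c s \<and> prefix s t \<longrightarrow> loaded (label T s)))"

definition free_repeat :: "('p, 'a) tableau \<Rightarrow> nat list \<Rightarrow> bool" where
  "free_repeat T t \<longleftrightarrow> repeat T t \<and> free (label T t)"

definition pdl_tableau :: "('p, 'a) tableau \<Rightarrow> bool" where
  "pdl_tableau T \<longleftrightarrow> is_tableau T \<and>
     (\<forall>t. loaded_path_repeat T t \<or> free_repeat T t \<longrightarrow> leaf T t)"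

definition closed_pdl_tableau :: "('p, 'a) tableau \<Rightarrow> bool" where
  "closed_pdl_tableau T \<longleftrightarrow> pdl_tableau T \<and>
     (\<forall>t. leaf T t \<longrightarrow> closed_sequent (label T t) \<or> loaded_path_repeat T t)"

end

theory Submission
  imports Defs "HOL-Library.Multiset"
begin

text \<open>
  In the product of a model with a clock that ticks at every atomic step, a true loaded formula
  comes with a bound \<open>n\<close> on the time in which a path through its marked programs reaches a state
  refuting the unmarked rest.  Every rule has a child that is satisfied again.  Below a loaded
  node it can be chosen such that \<open>n\<close> drops (rule \<open>M\<close>), or stays and the label drops in the
  multiset order of formula weights.  Below a free node the set of labels of free ancestors grows,
  since free repeats are leaves; it cannot grow forever, since all labels are built from one
  finite Fischer-Ladner closure.  So the triple of the number of labels missing from that set,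
  the bound \<open>n\<close> and the label decreases lexicographically along satisfied nodes.  A satisfied leaf
  is a loaded-path repeat, whose companion is an interior node with the same triple.  Hence no
  node is satisfied.
\<close>

section \<open>Program unfolding\<close>

lemmas prog_induct [case_names Atom Test Choice Seq Star] =
  prog.induct[of "\<lambda>_. True", OF TrueI TrueI TrueI TrueI TrueI]

lemma boxes_Nil [simp]: "boxes [] \<psi> = \<psi>"
  by (simp add: boxes_def)

lemma boxes_Cons [simp]: "boxes (\<delta> # \<delta>s) \<psi> = Box \<delta> (boxes \<delta>s \<psi>)"
  by (simp add: boxes_def)

lemma boxes_snoc: "boxes (\<delta>s @ [\<beta>]) \<psi> = boxes \<delta>s (Box \<beta> \<psi>)"
  by (simp add: boxes_def)

primrec path_rel :: "('w, 'p, 'a) kripke \<Rightarrow> ('p, 'a) prog list \<Rightarrow> ('w \<times> 'w) set" where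
  "path_rel M [] = Id"
| "path_rel M (\<delta> # \<delta>s) = prog_rel M \<delta> O path_rel M \<delta>s"

lemma path_rel_snoc: "path_rel M (\<delta>s @ [\<beta>]) = path_rel M \<delta>s O prog_rel M \<beta>"
  by (induction \<delta>s) (simp_all add: O_assoc)

lemma sat_boxes: "sat M (boxes \<delta>s \<psi>) w \<longleftrightarrow> (\<forall>v. (w, v) \<in> path_rel M \<delta>s \<longrightarrow> sat M \<psi> v)"
  by (induction \<delta>s arbitrary: w) auto

definition unfold_rel :: "('w, 'p, 'a) kripke \<Rightarrow> ('p, 'a) prog \<Rightarrow> ('w \<times> 'w) set" where
  "unfold_rel M \<alpha> =
     {(w, v). \<exists>(Y, \<delta>s)\<in>Hset \<alpha>. (\<forall>\<tau>\<in>Y. sat M \<tau> w) \<and> (w, v) \<in> path_rel M \<delta>s}"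

lemma unfold_relI:
  "(Y, \<delta>s) \<in> Hset \<alpha> \<Longrightarrow> \<forall>\<tau>\<in>Y. sat M \<tau> w \<Longrightarrow> (w, v) \<in> path_rel M \<delta>s \<Longrightarrow> (w, v) \<in> unfold_rel M \<alpha>"
  by (auto simp: unfold_rel_def)

lemma unfold_relE:
  assumes "(w, v) \<in> unfold_rel M \<alpha>"
  obtains Y \<delta>s where "(Y, \<delta>s) \<in> Hset \<alpha>" "\<forall>\<tau>\<in>Y. sat M \<tau> w" "(w, v) \<in> path_rel M \<delta>s"
  using assms by (auto simp: unfold_rel_def)

lemma unfold_rel_simps [simp]:
  "unfold_rel M (Atom a) = rel M a"
  "unfold_rel M (Test \<tau>) = {(w, w) |w. sat M \<tau> w}"
  "unfold_rel M (Choice \<alpha> \<beta>) = unfold_rel M \<alpha> \<union> unfold_rel M \<beta>"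
  by (auto simp: unfold_rel_def)

lemma unfold_rel_Seq_subset:
  "unfold_rel M (Seq \<alpha> \<beta>) \<subseteq> unfold_rel M \<alpha> O (prog_rel M \<beta> \<union> unfold_rel M \<beta>)"
proof (rule subrelI, erule unfold_relE)
  fix w v Y \<delta>s
  assume tests: "\<forall>\<tau>\<in>Y. sat M \<tau> w" and path: "(w, v) \<in> path_rel M \<delta>s"
  assume "(Y, \<delta>s) \<in> Hset (Seq \<alpha> \<beta>)"
  then consider (step) \<epsilon>s where "\<delta>s = \<epsilon>s @ [\<beta>]" "(Y, \<epsilon>s) \<in> Hset \<alpha>"
    | (skip) Y\<^sub>1 Y\<^sub>2 where "Y = Y\<^sub>1 \<union> Y\<^sub>2" "(Y\<^sub>1, []) \<in> Hset \<alpha>" "(Y\<^sub>2, \<delta>s) \<in> Hset \<beta>"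
    by auto
  then show "(w, v) \<in> unfold_rel M \<alpha> O (prog_rel M \<beta> \<union> unfold_rel M \<beta>)"
  proof cases
    case step
    with path obtain u where "(w, u) \<in> path_rel M \<epsilon>s" "(u, v) \<in> prog_rel M \<beta>"
      by (auto simp: path_rel_snoc)
    with step tests show ?thesis by (auto intro: unfold_relI)
  next
    case skip
    with path tests have "(w, w) \<in> unfold_rel M \<alpha>" "(w, v) \<in> unfold_rel M \<beta>"
      by (auto intro: unfold_relI)
    then show ?thesis by blast
  qed
qed

lemma unfold_rel_Star_subset:
  "unfold_rel M (Star \<alpha>) \<subseteq> Id \<union> unfold_rel M \<alpha> O (prog_rel M \<alpha>)\<^sup>*"
proof (rule subrelI, erule unfold_relE)
  fix w v Y \<delta>s
  assume tests: "\<forall>\<tau>\<in>Y. sat M \<tau> w" and path: "(w, v) \<in> path_rel M \<delta>s"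
  assume "(Y, \<delta>s) \<in> Hset (Star \<alpha>)"
  then consider (stop) "\<delta>s = []" | (step) \<epsilon>s where "\<delta>s = \<epsilon>s @ [Star \<alpha>]" "(Y, \<epsilon>s) \<in> Hset \<alpha>"
    by auto
  then show "(w, v) \<in> Id \<union> unfold_rel M \<alpha> O (prog_rel M \<alpha>)\<^sup>*"
  proof cases
    case stop
    with path show ?thesis by simp
  next
    case step
    with path obtain u where "(w, u) \<in> path_rel M \<epsilon>s" "(u, v) \<in> (prog_rel M \<alpha>)\<^sup>*"
      by (auto simp: path_rel_snoc)
    with step tests show ?thesis by (auto intro: unfold_relI)
  qed
qed

lemma unfold_rel_subset_prog_rel: "unfold_rel M \<alpha> \<subseteq> prog_rel M \<alpha>"
proof (induction \<alpha> rule: prog_induct)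
  case (Seq \<alpha> \<beta>)
  then have "unfold_rel M \<alpha> O (prog_rel M \<beta> \<union> unfold_rel M \<beta>) \<subseteq> prog_rel M (Seq \<alpha> \<beta>)" by auto
  with unfold_rel_Seq_subset show ?case by (rule subset_trans)
next
  case (Star \<alpha>)
  then have "Id \<union> unfold_rel M \<alpha> O (prog_rel M \<alpha>)\<^sup>* \<subseteq> prog_rel M (Star \<alpha>)"
    by (auto intro: converse_rtrancl_into_rtrancl)
  with unfold_rel_Star_subset show ?case by (rule subset_trans)
qed auto

lemma relcomp_subset_unfold_rel_Seq: "unfold_rel M \<alpha> O unfold_rel M \<beta> \<subseteq> unfold_rel M (Seq \<alpha> \<beta>)"
proof (rule subrelI, elim relcompEpair)
  fix w u v
  assume "(w, u) \<in> unfold_rel M \<alpha>" and u: "(u, v) \<in> unfold_rel M \<beta>"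
  then obtain Y \<delta>s where
    Y: "(Y, \<delta>s) \<in> Hset \<alpha>" "\<forall>\<tau>\<in>Y. sat M \<tau> w" "(w, u) \<in> path_rel M \<delta>s" by (elim unfold_relE)
  show "(w, v) \<in> unfold_rel M (Seq \<alpha> \<beta>)"
  proof (cases "\<delta>s = []")
    case True
    from u obtain Z \<epsilon>s where
      "(Z, \<epsilon>s) \<in> Hset \<beta>" "\<forall>\<tau>\<in>Z. sat M \<tau> u" "(u, v) \<in> path_rel M \<epsilon>s" by (elim unfold_relE)
    with Y True show ?thesis by (intro unfold_relI[of "Y \<union> Z" \<epsilon>s]) auto
  next
    case False
    have "(u, v) \<in> prog_rel M \<beta>" using u unfold_rel_subset_prog_rel by blast
    with Y False show ?thesis
      by (intro unfold_relI[of Y "\<delta>s @ [\<beta>]"]) (auto simp: path_rel_snoc)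
  qed
qed

lemma rtrancl_subset_unfold_rel_Star:
  assumes "prog_rel M \<alpha> \<subseteq> unfold_rel M \<alpha>"
  shows "(prog_rel M \<alpha>)\<^sup>* \<subseteq> unfold_rel M (Star \<alpha>)"
proof (rule subrelI)
  fix w v
  assume "(w, v) \<in> (prog_rel M \<alpha>)\<^sup>*"
  then show "(w, v) \<in> unfold_rel M (Star \<alpha>)"
  proof (induction rule: converse_rtrancl_induct)
    case base
    show ?case by (rule unfold_relI[of "{}" "[]"]) auto
  next
    case (step w u)
    from step.hyps(1) assms have "(w, u) \<in> unfold_rel M \<alpha>" by blast
    then obtain Y \<delta>s where
      Y: "(Y, \<delta>s) \<in> Hset \<alpha>" "\<forall>\<tau>\<in>Y. sat M \<tau> w" "(w, u) \<in> path_rel M \<delta>s" by (rule unfold_relE)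
    show ?case
    proof (cases "\<delta>s = []")
      case True
      with Y step.IH show ?thesis by simp
    next
      case False
      with Y step.hyps(2) show ?thesis
        by (intro unfold_relI[of Y "\<delta>s @ [Star \<alpha>]"]) (auto simp: path_rel_snoc)
    qed
  qed
qed

lemma prog_rel_eq_unfold_rel: "prog_rel M \<alpha> = unfold_rel M \<alpha>"
proof (rule equalityI[OF _ unfold_rel_subset_prog_rel], induction \<alpha> rule: prog_induct)
  case (Seq \<alpha> \<beta>)
  then have "prog_rel M (Seq \<alpha> \<beta>) \<subseteq> unfold_rel M \<alpha> O unfold_rel M \<beta>" by auto
  also have "\<dots> \<subseteq> unfold_rel M (Seq \<alpha> \<beta>)" by (rule relcomp_subset_unfold_rel_Seq)
  finally show ?case .
next
  case (Star \<alpha>)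
  then show ?case by (simp add: rtrancl_subset_unfold_rel_Star)
qed auto

lemma Pset_imp_Hset: "\<delta>s \<in> Pset l \<alpha> \<Longrightarrow> \<exists>Y\<subseteq>l. (Y, \<delta>s) \<in> Hset \<alpha>"
proof (induction \<alpha> arbitrary: \<delta>s rule: prog_induct)
  case (Seq \<alpha> \<beta>)
  from Seq.prems consider
      (step) \<epsilon>s where "\<delta>s = \<epsilon>s @ [\<beta>]" "\<epsilon>s \<noteq> []" "\<epsilon>s \<in> Pset l \<alpha>"
    | (skip) "[] \<in> Pset l \<alpha>" "\<delta>s \<in> Pset l \<beta>"
    by auto
  then show ?case
  proof cases
    case step
    with Seq.IH(1)[of \<epsilon>s] show ?thesis by auto
  next
    case skip
    then obtain Y Z where "Y \<union> Z \<subseteq> l" "(Y, []) \<in> Hset \<alpha>" "(Z, \<delta>s) \<in> Hset \<beta>"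
      using Seq.IH by (meson Un_least)
    then have "(Y \<union> Z, \<delta>s) \<in> Hset (Seq \<alpha> \<beta>)" by auto
    with \<open>Y \<union> Z \<subseteq> l\<close> show ?thesis by blast
  qed
next
  case (Star \<alpha>)
  from Star.prems consider (stop) "\<delta>s = []"
    | (step) \<epsilon>s where "\<delta>s = \<epsilon>s @ [Star \<alpha>]" "\<epsilon>s \<noteq> []" "\<epsilon>s \<in> Pset l \<alpha>"
    by auto
  then show ?case
  proof cases
    case stop
    then show ?thesis by auto
  next
    case step
    with Star.IH[of \<epsilon>s] show ?thesis by auto
  qed
next
  case (Choice \<alpha> \<beta>)
  from Choice.prems Choice.IH[of \<delta>s] show ?case by auto
next
  case (Test \<tau>)
  then show ?case by (simp split: if_splits)
qed simp

lemma unfold_box_sat: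
  assumes "sat M (Box \<alpha> \<psi>) w"
  shows "\<exists>\<Gamma>\<in>unfold_box \<alpha> \<psi>. \<forall>\<phi>\<in>\<Gamma>. sat M \<phi> w"
proof
  define l where "l = {\<tau> \<in> Tests \<alpha>. sat M \<tau> w}"
  show "Xset l \<alpha> \<psi> \<in> unfold_box \<alpha> \<psi>" by (auto simp: unfold_box_def l_def)
  have "sat M (boxes \<delta>s \<psi>) w" if "\<delta>s \<in> Pset l \<alpha>" for \<delta>s
    unfolding sat_boxes
  proof (intro allI impI)
    fix v
    assume "(w, v) \<in> path_rel M \<delta>s"
    moreover from that obtain Y where Y: "Y \<subseteq> l" "(Y, \<delta>s) \<in> Hset \<alpha>" using Pset_imp_Hset by blast
    moreover from Y(1) have "\<forall>\<tau>\<in>Y. sat M \<tau> w" by (auto simp: l_def)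
    ultimately have "(w, v) \<in> unfold_rel M \<alpha>" by (intro unfold_relI)
    with assms show "sat M \<psi> v" by (simp add: prog_rel_eq_unfold_rel)
  qed
  then show "\<forall>\<phi>\<in>Xset l \<alpha> \<psi>. sat M \<phi> w"
    by (auto simp: Xset_def Fset_def l_def)
qed

lemma unfold_dia_sat:
  assumes "sat M (Neg (Box \<alpha> \<psi>)) w"
  shows "\<exists>\<Gamma>\<in>unfold_dia \<alpha> \<psi>. \<forall>\<phi>\<in>\<Gamma>. sat M \<phi> w"
proof -
  from assms obtain v where v: "(w, v) \<in> unfold_rel M \<alpha>" "\<not> sat M \<psi> v"
    by (auto simp: prog_rel_eq_unfold_rel)
  from v(1) obtain Y \<delta>s where
    Y: "(Y, \<delta>s) \<in> Hset \<alpha>" "\<forall>\<tau>\<in>Y. sat M \<tau> w" "(w, v) \<in> path_rel M \<delta>s" by (rule unfold_relE)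
  show ?thesis
  proof
    show "Y \<union> {Neg (boxes \<delta>s \<psi>)} \<in> unfold_dia \<alpha> \<psi>" using Y(1) by (auto simp: unfold_dia_def)
    show "\<forall>\<phi>\<in>Y \<union> {Neg (boxes \<delta>s \<psi>)}. sat M \<phi> w" using Y v(2) by (auto simp: sat_boxes)
  qed
qed

section \<open>Clocked models\<close>

definition bounded_morphism ::
  "('v \<Rightarrow> 'w) \<Rightarrow> ('v, 'p, 'a) kripke \<Rightarrow> ('w, 'p, 'a) kripke \<Rightarrow> bool" where
  "bounded_morphism f M N \<longleftrightarrow>
     (\<forall>p w. f w \<in> val N p \<longleftrightarrow> w \<in> val M p) \<and>
     (\<forall>a w. rel N a `` {f w} = f ` (rel M a `` {w}))"

lemma Image_rtrancl_eq_image: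
  assumes "\<And>w. S `` {f w} = f ` (R `` {w})"
  shows "S\<^sup>* `` {f w} = f ` (R\<^sup>* `` {w})"
proof (intro equalityI subsetI)
  fix y
  assume "y \<in> S\<^sup>* `` {f w}"
  then have "(f w, y) \<in> S\<^sup>*" by simp
  then show "y \<in> f ` (R\<^sup>* `` {w})"
  proof induction
    case (step y z)
    then obtain v where "(w, v) \<in> R\<^sup>*" "y = f v" by auto
    moreover from this step.hyps(2) have "z \<in> f ` (R `` {v})" by (simp flip: assms)
    ultimately show ?case by (auto intro: rtrancl_into_rtrancl)
  qed auto
next
  fix y
  assume "y \<in> f ` (R\<^sup>* `` {w})"
  then obtain v where "(w, v) \<in> R\<^sup>*" and y: "y = f v" by auto
  from this(1) have "(f w, f v) \<in> S\<^sup>*"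
  proof induction
    case (step u v)
    moreover have "(f u, f v) \<in> S" using step.hyps(2) assms[of u] by auto
    ultimately show ?case by (simp add: rtrancl_into_rtrancl)
  qed simp
  with y show "y \<in> S\<^sup>* `` {f w}" by simp
qed

lemma bounded_morphism_sat:
  fixes \<phi> :: "('p, 'a) fml" and \<alpha> :: "('p, 'a) prog"
  assumes "bounded_morphism f M N"
  shows "sat N \<phi> (f w) \<longleftrightarrow> sat M \<phi> w"
    and "prog_rel N \<alpha> `` {f w} = f ` (prog_rel M \<alpha> `` {w})"
proof -
  have "\<forall>w. sat N \<phi> (f w) \<longleftrightarrow> sat M \<phi> w"
    and "\<forall>w. prog_rel N \<alpha> `` {f w} = f ` (prog_rel M \<alpha> `` {w})"
  proof (induction \<phi> and \<alpha>)
    case (Box \<alpha> \<phi>)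
    have "sat N (Box \<alpha> \<phi>) (f w) \<longleftrightarrow> (\<forall>v\<in>prog_rel N \<alpha> `` {f w}. sat N \<phi> v)" for w by auto
    with Box show ?case by auto
  next
    case (Choice \<alpha> \<beta>)
    then show ?case by (simp add: image_Un Un_Image)
  next
    case (Seq \<alpha> \<beta>)
    have "prog_rel N \<beta> `` (f ` X) = f ` (prog_rel M \<beta> `` X)" for X
    proof -
      have "prog_rel N \<beta> `` (f ` X) = (\<Union>w\<in>X. prog_rel N \<beta> `` {f w})" by blast
      also have "\<dots> = (\<Union>w\<in>X. f ` (prog_rel M \<beta> `` {w}))" using Seq(2) by simp
      finally show ?thesis by blast
    qed
    with Seq(1) show ?case by (simp add: relcomp_Image)
  next
    case (Star \<alpha>)
    then show ?case by (simp add: Image_rtrancl_eq_image)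
  next
    case (Test \<phi>)
    then show ?case by auto
  qed (use assms in \<open>simp_all add: bounded_morphism_def\<close>)
  then show "sat N \<phi> (f w) \<longleftrightarrow> sat M \<phi> w"
    and "prog_rel N \<alpha> `` {f w} = f ` (prog_rel M \<alpha> `` {w})" by blast+
qed

definition clock_product :: "('w, 'p, 'a) kripke \<Rightarrow> ('w \<times> nat, 'p, 'a) kripke" where
  "clock_product M =
     \<lparr>rel = \<lambda>a. {((w, n), (v, Suc n)) |w v n. (w, v) \<in> rel M a}, val = \<lambda>p. val M p \<times> UNIV\<rparr>"

lemma bounded_morphism_fst_clock_product: "bounded_morphism fst (clock_product M) M"
  by (force simp: bounded_morphism_def clock_product_def)

lemma sat_clock_product: "sat (clock_product M) \<phi> (w, n) \<longleftrightarrow> sat M \<phi> w"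
  using bounded_morphism_sat(1)[OF bounded_morphism_fst_clock_product, of M \<phi> "(w, n)"] by simp

locale clocked_model =
  fixes M :: "('w, 'p, 'a) kripke" and clock :: "'w \<Rightarrow> nat"
  assumes clock_Suc: "(w, v) \<in> rel M a \<Longrightarrow> clock v = Suc (clock w)"

lemma clocked_model_clock_product: "clocked_model (clock_product M) snd"
  by (auto simp: clocked_model_def clock_product_def)

primrec refutation :: "('w, 'p, 'a) kripke \<Rightarrow> ('p, 'a) xi \<Rightarrow> ('w \<times> 'w) set" where
  "refutation M (Plain \<phi>) = {(w, w) |w. \<not> sat M \<phi> w}"
| "refutation M (LBox \<alpha> \<xi>) = prog_rel M \<alpha> O refutation M \<xi>"

lemma refutation_lboxes: "refutation M (lboxes \<delta>s \<xi>) = path_rel M \<delta>s O refutation M \<xi>"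
  by (induction \<delta>s) (simp_all add: lboxes_def O_assoc)

lemma ex_refutation_iff: "(\<exists>v. (w, v) \<in> refutation M \<xi>) \<longleftrightarrow> \<not> sat M (unmark_xi \<xi>) w"
  by (induction \<xi> arbitrary: w) (simp_all add: relcomp_unfold, blast)

lemma unmark_neg_xi [simp]: "unmark (neg_xi \<xi>) = Neg (unmark_xi \<xi>)"
  by (cases \<xi>) auto

lemma unmark_xi_lboxes [simp]: "unmark_xi (lboxes \<delta>s \<xi>) = boxes \<delta>s (unmark_xi \<xi>)"
  by (induction \<delta>s) (auto simp: lboxes_def)

context clocked_model
begin

lemma clock_mono_prog_rel: "(w, v) \<in> prog_rel M \<alpha> \<Longrightarrow> clock w \<le> clock v"
proof (induction \<alpha> arbitrary: w v rule: prog_induct)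
  case (Seq \<alpha> \<beta>)
  then show ?case by (force intro: order_trans)
next
  case (Star \<alpha>)
  from Star.prems have "(w, v) \<in> (prog_rel M \<alpha>)\<^sup>*" by simp
  then show ?case by induction (auto dest: Star.IH)
qed (auto simp: clock_Suc)

lemma clock_mono_refutation: "(w, v) \<in> refutation M \<xi> \<Longrightarrow> clock w \<le> clock v"
  by (induction \<xi> arbitrary: w) (auto dest: clock_mono_prog_rel intro: order_trans)

primrec holds_within :: "nat \<Rightarrow> 'w \<Rightarrow> ('p, 'a) sfml \<Rightarrow> bool" where
  "holds_within n w (Fml \<phi>) \<longleftrightarrow> sat M \<phi> w"
| "holds_within n w (NegLBox \<alpha> \<xi>) \<longleftrightarrow>
     (\<exists>v. (w, v) \<in> refutation M (LBox \<alpha> \<xi>) \<and> clock v \<le> clock w + n)"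

definition sat_within :: "nat \<Rightarrow> 'w \<Rightarrow> ('p, 'a) sequent \<Rightarrow> bool" where
  "sat_within n w \<Gamma> \<longleftrightarrow> (\<forall>x\<in>\<Gamma>. holds_within n w x)"

lemma sat_within_insert [simp]:
  "sat_within n w (insert x \<Gamma>) \<longleftrightarrow> holds_within n w x \<and> sat_within n w \<Gamma>"
  by (simp add: sat_within_def)

lemma sat_within_Un [simp]:
  "sat_within n w (\<Gamma> \<union> \<Delta>) \<longleftrightarrow> sat_within n w \<Gamma> \<and> sat_within n w \<Delta>"
  by (auto simp: sat_within_def)

lemma sat_within_empty [simp]: "sat_within n w {}"
  by (simp add: sat_within_def)

lemma sat_within_Fml_image [simp]: "sat_within n w (Fml ` \<Gamma>) \<longleftrightarrow> (\<forall>\<phi>\<in>\<Gamma>. sat M \<phi> w)"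
  by (simp add: sat_within_def)

lemma holds_within_neg_xi:
  "holds_within n w (neg_xi \<xi>) \<longleftrightarrow> (\<exists>v. (w, v) \<in> refutation M \<xi> \<and> clock v \<le> clock w + n)"
  by (cases \<xi>) auto

lemma ex_holds_within_iff: "(\<exists>n. holds_within n w x) \<longleftrightarrow> sat M (unmark x) w"
proof (cases x)
  case (NegLBox \<alpha> \<xi>)
  have "(\<exists>n. holds_within n w x) \<longleftrightarrow> (\<exists>v. (w, v) \<in> refutation M (LBox \<alpha> \<xi>))"
    unfolding NegLBox holds_within.simps by (meson le_add2)
  then show ?thesis unfolding ex_refutation_iff by (simp add: NegLBox)
qed simp

lemma holds_within_mono: "holds_within m w x \<Longrightarrow> m \<le> n \<Longrightarrow> holds_within n w x"
  by (cases x) (auto simp del: refutation.simps intro: order_trans)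

lemma sat_within_mono: "sat_within m w \<Gamma> \<Longrightarrow> m \<le> n \<Longrightarrow> sat_within n w \<Gamma>"
  by (auto simp: sat_within_def intro: holds_within_mono)

lemma sat_sequent_imp_sat_within:
  assumes "finite \<Gamma>" "sat_sequent M w \<Gamma>"
  obtains n where "sat_within n w \<Gamma>"
proof -
  have "\<exists>n. sat_within n w \<Gamma>"
    using assms
  proof (induction \<Gamma>)
    case (insert x \<Gamma>)
    then obtain m n where "holds_within m w x" "sat_within n w \<Gamma>"
      using ex_holds_within_iff[of w x] by (auto simp: sat_sequent_def)
    then have "sat_within (max m n) w (insert x \<Gamma>)"
      by (auto intro: holds_within_mono[of m] sat_within_mono[of n])
    then show ?case by blast
  qed simp
  then show thesis using that by blast
qed

lemma closed_sequent_not_sat_within: "closed_sequent \<Gamma> \<Longrightarrow> \<not> sat_within n w \<Gamma>"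
  unfolding closed_sequent_def sat_within_def
  by (metis holds_within.simps(1) sat.simps(1,3))

end

section \<open>Rule instances\<close>

text \<open>
  \<open>expands x \<Y>\<close>: below a principal formula \<open>x\<close> and its context, a rule other than \<open>L+\<close> and \<open>M\<close>
  puts the sets in \<open>\<Y>\<close> together with the same context.
\<close>

inductive expands :: "('p, 'a) sfml \<Rightarrow> ('p, 'a) sequent set \<Rightarrow> bool" where
  Neg: "expands (Fml (Neg (Neg \<phi>))) {{Fml \<phi>}}"
| Conj: "expands (Fml (Conj \<phi> \<psi>)) {{Fml \<phi>, Fml \<psi>}}"
| NegConj: "expands (Fml (Neg (Conj \<phi> \<psi>))) {{Fml (Neg \<phi>)}, {Fml (Neg \<psi>)}}"
| Box: "\<not> is_atomic \<alpha> \<Longrightarrow> expands (Fml (Box \<alpha> \<phi>)) ((`) Fml ` unfold_box \<alpha> \<phi>)"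
| Dia: "\<not> is_atomic \<alpha> \<Longrightarrow> expands (Fml (Neg (Box \<alpha> \<phi>))) ((`) Fml ` unfold_dia \<alpha> \<phi>)"
| LDia: "\<not> is_atomic \<alpha> \<Longrightarrow> expands (NegLBox \<alpha> \<xi>) (unfold_ldia \<alpha> \<xi>)"
| LMinus: "expands (NegLBox \<alpha> \<xi>) {{Fml (unmark (NegLBox \<alpha> \<xi>))}}"

lemma rule_inst_cases:
  assumes "rule_inst r \<Gamma> C"
  obtains
    (expand) x \<Delta> \<Y> where "\<Gamma> = insert x \<Delta>" "x \<notin> \<Delta>" "expands x \<Y>" "C = {\<Delta> \<union> Y |Y. Y \<in> \<Y>}"
  | (load) x \<Delta> where "\<Gamma> = insert (Fml (unmark x)) \<Delta>" "free \<Gamma>" "C = {insert x \<Delta>}"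
  | (project) a \<xi> \<Delta> where
      "\<Gamma> = insert (NegLBox (Atom a) \<xi>) \<Delta>" "C = {insert (neg_xi \<xi>) (proj a \<Delta>)}"
  using assms
proof cases
  case (neg \<phi> \<Delta>)
  then show thesis by (intro expand[OF _ _ expands.Neg]) auto
next
  case (conj \<phi> \<psi> \<Delta>)
  then show thesis by (intro expand[OF _ _ expands.Conj]) auto
next
  case (neg_conj \<phi> \<psi> \<Delta>)
  then show thesis by (intro expand[OF _ _ expands.NegConj]) auto
next
  case (box \<alpha> \<phi> \<Delta>)
  then show thesis by (intro expand[OF _ _ expands.Box]) auto
next
  case (dia \<alpha> \<phi> \<Delta>)
  then show thesis by (intro expand[OF _ _ expands.Dia]) auto
next
  case (ldia \<alpha> \<xi> \<Delta>)
  then show thesis by (intro expand[OF _ _ expands.LDia]) auto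
next
  case (lplus a \<alpha>s \<phi> \<Delta>)
  then show thesis
    by (intro load[of "neg_xi (lboxes (Atom a # \<alpha>s) (Plain \<phi>))"]) (auto simp: loaded_def)
next
  case (lminus \<alpha>s \<phi> \<Delta>)
  then obtain \<alpha> \<xi> where "neg_xi (lboxes \<alpha>s (Plain \<phi>)) = NegLBox \<alpha> \<xi>"
    by (cases \<alpha>s) (auto simp: lboxes_def)
  moreover from this have "unmark (NegLBox \<alpha> \<xi>) = Neg (boxes \<alpha>s \<phi>)"
    by (metis unmark_neg_xi unmark_xi_lboxes unmark_xi.simps(1))
  ultimately show thesis
    using lminus by (intro expand[OF _ _ expands.LMinus]) auto
next
  case (modal a \<xi> \<Delta>)
  then show thesis by (intro project)
qed

lemma (in clocked_model) unfold_ldia_sat_within: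
  assumes "holds_within n w (NegLBox \<alpha> \<xi>)"
  shows "\<exists>\<Gamma>\<in>unfold_ldia \<alpha> \<xi>. sat_within n w \<Gamma>"
proof -
  from assms obtain u v where
    v: "(w, u) \<in> unfold_rel M \<alpha>" "(u, v) \<in> refutation M \<xi>" "clock v \<le> clock w + n"
    by (auto simp: prog_rel_eq_unfold_rel)
  from v(1) obtain Y \<delta>s where
    Y: "(Y, \<delta>s) \<in> Hset \<alpha>" "\<forall>\<tau>\<in>Y. sat M \<tau> w" "(w, u) \<in> path_rel M \<delta>s" by (rule unfold_relE)
  show ?thesis
  proof
    show "Fml ` Y \<union> {neg_xi (lboxes \<delta>s \<xi>)} \<in> unfold_ldia \<alpha> \<xi>"
      using Y(1) by (auto simp: unfold_ldia_def)
    show "sat_within n w (Fml ` Y \<union> {neg_xi (lboxes \<delta>s \<xi>)})"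
      using Y(2,3) v(2,3) by (auto simp: holds_within_neg_xi refutation_lboxes)
  qed
qed

lemma (in clocked_model) expands_sat_within:
  assumes "expands x \<Y>" "holds_within n w x"
  shows "\<exists>Y\<in>\<Y>. sat_within n w Y"
  using assms
proof cases
  case (Box \<alpha> \<phi>)
  with assms(2) unfold_box_sat[of M \<alpha> \<phi> w] show ?thesis by simp
next
  case (Dia \<alpha> \<phi>)
  with assms(2) unfold_dia_sat[of M \<alpha> \<phi> w] show ?thesis by simp
next
  case (LDia \<alpha> \<xi>)
  with assms(2) unfold_ldia_sat_within show ?thesis by blast
next
  case (LMinus \<alpha> \<xi>)
  with assms(2) show ?thesis using ex_holds_within_iff[of w x] by auto
qed (use assms(2) in auto)

lemma size_Tests: "\<tau> \<in> Tests \<alpha> \<Longrightarrow> size \<tau> < size \<alpha>"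
  by (induction \<alpha> rule: prog_induct) auto

lemma Hset_subset_Tests: "(Y, \<delta>s) \<in> Hset \<alpha> \<Longrightarrow> Y \<subseteq> Tests \<alpha>"
  by (induction \<alpha> arbitrary: Y \<delta>s rule: prog_induct) (auto, blast+)

lemma Hset_hd_atomic: "(Y, \<delta> # \<delta>s) \<in> Hset \<alpha> \<Longrightarrow> is_atomic \<delta>"
proof (induction \<alpha> arbitrary: Y \<delta>s rule: prog_induct)
  case (Seq \<alpha> \<beta>)
  then show ?case by (auto simp: Cons_eq_append_conv)
qed (auto simp: is_atomic_def Cons_eq_append_conv)

text \<open>
  Basic formulas weigh nothing, because unfolding \<open>[\<alpha>]\<psi>\<close> can create formulas \<open>[a]\<phi>\<close> that are larger
  than \<open>[\<alpha>]\<psi>\<close>.  The extra \<open>Suc\<close> for loaded formulas makes the rule \<open>L-\<close> decrease the weight.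
\<close>

definition fml_weight :: "('p, 'a) fml \<Rightarrow> nat" where
  "fml_weight \<phi> = (if basic_sfml (Fml \<phi>) then 0 else size \<phi>)"

primrec weight :: "('p, 'a) sfml \<Rightarrow> nat" where
  "weight (Fml \<phi>) = fml_weight \<phi>"
| "weight (NegLBox \<alpha> \<xi>) = Suc (fml_weight (Neg (Box \<alpha> (unmark_xi \<xi>))))"

lemma basic_sfml_iffs [simp]:
  "\<not> basic_sfml (Fml (Neg (Neg \<phi>)))" "\<not> basic_sfml (Fml (Conj \<phi> \<psi>))"
  "\<not> basic_sfml (Fml (Neg (Conj \<phi> \<psi>)))"
  "basic_sfml (Fml (Box \<alpha> \<phi>)) \<longleftrightarrow> is_atomic \<alpha>"
  "basic_sfml (Fml (Neg (Box \<alpha> \<phi>))) \<longleftrightarrow> is_atomic \<alpha>"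
  by (auto simp: basic_sfml.simps is_atomic_def)

lemma fml_weight_le_size: "fml_weight \<phi> \<le> size \<phi>"
  by (simp add: fml_weight_def)

lemma weight_le_Suc_fml_weight_unmark: "weight x \<le> Suc (fml_weight (unmark x))"
  by (cases x) auto

lemma fml_weight_boxes_Hset:
  assumes "(Y, \<delta>s) \<in> Hset \<alpha>"
  shows "fml_weight (boxes \<delta>s \<psi>) \<le> size \<psi>" "fml_weight (Neg (boxes \<delta>s \<psi>)) \<le> Suc (size \<psi>)"
  using assms Hset_hd_atomic by (cases \<delta>s; force simp: fml_weight_def)+

lemma unfold_box_fml_weight:
  assumes "\<not> is_atomic \<alpha>" "\<Gamma> \<in> unfold_box \<alpha> \<psi>" "\<phi> \<in> \<Gamma>"
  shows "fml_weight \<phi> < fml_weight (Box \<alpha> \<psi>)"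
proof -
  from assms(2,3) consider (test) \<tau> where "\<tau> \<in> Tests \<alpha>" "\<phi> = Neg \<tau>"
    | (path) Y \<delta>s where "(Y, \<delta>s) \<in> Hset \<alpha>" "\<phi> = boxes \<delta>s \<psi>"
    by (auto simp: unfold_box_def Xset_def Fset_def dest: Pset_imp_Hset)
  then have "fml_weight \<phi> < size (Box \<alpha> \<psi>)"
  proof cases
    case test
    with size_Tests[of \<tau> \<alpha>] fml_weight_le_size[of \<phi>] show ?thesis by simp
  next
    case path
    with fml_weight_boxes_Hset(1)[of Y \<delta>s \<alpha> \<psi>] show ?thesis by simp
  qed
  with assms(1) show ?thesis by (simp add: fml_weight_def)
qed

lemma unfold_dia_fml_weight:
  assumes "\<not> is_atomic \<alpha>" "\<Gamma> \<in> unfold_dia \<alpha> \<psi>" "\<phi> \<in> \<Gamma>"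
  shows "fml_weight \<phi> < fml_weight (Neg (Box \<alpha> \<psi>))"
proof -
  from assms(2,3) consider (test) "\<phi> \<in> Tests \<alpha>"
    | (path) Y \<delta>s where "(Y, \<delta>s) \<in> Hset \<alpha>" "\<phi> = Neg (boxes \<delta>s \<psi>)"
    by (auto simp: unfold_dia_def dest: Hset_subset_Tests)
  then have "fml_weight \<phi> < size (Neg (Box \<alpha> \<psi>))"
  proof cases
    case test
    with size_Tests[of \<phi> \<alpha>] fml_weight_le_size[of \<phi>] show ?thesis by simp
  next
    case path
    with fml_weight_boxes_Hset(2)[of Y \<delta>s \<alpha> \<psi>] show ?thesis by simp
  qed
  with assms(1) show ?thesis by (simp add: fml_weight_def)
qed

lemma unmark_unfold_ldia:
  "\<Gamma> \<in> unfold_ldia \<alpha> \<xi> \<Longrightarrow> unmark ` \<Gamma> \<in> unfold_dia \<alpha> (unmark_xi \<xi>)"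
proof -
  assume "\<Gamma> \<in> unfold_ldia \<alpha> \<xi>"
  then obtain Y \<delta>s where "(Y, \<delta>s) \<in> Hset \<alpha>" "\<Gamma> = Fml ` Y \<union> {neg_xi (lboxes \<delta>s \<xi>)}"
    by (auto simp: unfold_ldia_def)
  moreover from this have "unmark ` \<Gamma> = Y \<union> {Neg (boxes \<delta>s (unmark_xi \<xi>))}"
    by (simp add: image_image)
  ultimately show ?thesis by (auto simp: unfold_dia_def)
qed

lemma expands_weight:
  assumes "expands x \<Y>" "Y \<in> \<Y>" "y \<in> Y"
  shows "weight y < weight x"
  using assms
proof cases
  case (Box \<alpha> \<phi>)
  with assms(2,3) show ?thesis by (auto intro: unfold_box_fml_weight)
next
  case (Dia \<alpha> \<phi>)
  with assms(2,3) show ?thesis by (auto intro: unfold_dia_fml_weight)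
next
  case (LDia \<alpha> \<xi>)
  with assms(2,3) have "fml_weight (unmark y) < fml_weight (Neg (Box \<alpha> (unmark_xi \<xi>)))"
    by (intro unfold_dia_fml_weight[OF _ unmark_unfold_ldia]) auto
  with LDia(1) weight_le_Suc_fml_weight_unmark[of y] show ?thesis by simp
qed (use assms(2,3) in \<open>auto simp: fml_weight_def\<close>)

definition sequent_less :: "(('p, 'a) sequent \<times> ('p, 'a) sequent) set" where
  "sequent_less = inv_image (mult (measure weight)) mset_set"

lemma wf_sequent_less: "wf sequent_less"
  by (simp add: sequent_less_def wf_mult)

lemma sequent_less_replace:
  assumes "finite (\<Delta> \<union> Y)" "x \<notin> \<Delta>" "\<And>y. y \<in> Y \<Longrightarrow> weight y < weight x"
  shows "(\<Delta> \<union> Y, insert x \<Delta>) \<in> sequent_less"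
proof -
  have "mset_set (\<Delta> \<union> Y) = mset_set \<Delta> + mset_set (Y - \<Delta>)"
    using assms(1) mset_set_Union[of \<Delta> "Y - \<Delta>"] by simp
  moreover have "mset_set (insert x \<Delta>) = mset_set \<Delta> + {#x#}"
    using assms(1,2) by simp
  moreover have "(mset_set \<Delta> + mset_set (Y - \<Delta>), mset_set \<Delta> + {#x#}) \<in> mult (measure weight)"
    using assms(1,3) by (intro one_step_implies_mult) auto
  ultimately show ?thesis by (simp add: sequent_less_def)
qed

lemma (in clocked_model) modal_sat_within:
  assumes "sat_within n w (insert (NegLBox (Atom a) \<xi>) \<Delta>)"
  shows "\<exists>m<n. \<exists>u. sat_within m u (insert (neg_xi \<xi>) (proj a \<Delta>))"
proof -
  from assms obtain u v where
    v: "(w, u) \<in> rel M a" "(u, v) \<in> refutation M \<xi>" "clock v \<le> clock w + n"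
    by auto
  have clock: "clock u = Suc (clock w)" "clock u \<le> clock v"
    using clock_Suc[OF v(1)] clock_mono_refutation[OF v(2)] by simp_all
  have "holds_within (n - 1) u (neg_xi \<xi>)"
    using v clock by (auto simp: holds_within_neg_xi)
  moreover have "sat_within (n - 1) u (proj a \<Delta>)"
    using assms v(1) by (fastforce simp: sat_within_def proj_def)
  moreover have "n - 1 < n" using v(3) clock by linarith
  ultimately show ?thesis by auto
qed

lemma (in clocked_model) rule_inst_sat_within:
  assumes "rule_inst r \<Gamma> C" "\<And>\<Gamma>'. \<Gamma>' \<in> C \<Longrightarrow> finite \<Gamma>'" "sat_within n w \<Gamma>"
  shows "\<exists>\<Gamma>'\<in>C. \<exists>m v. sat_within m v \<Gamma>' \<and>
    (loaded \<Gamma> \<longrightarrow> ((m, \<Gamma>'), (n, \<Gamma>)) \<in> less_than <*lex*> sequent_less)"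
  using assms(1)
proof (cases rule: rule_inst_cases)
  case (expand x \<Delta> \<Y>)
  with assms(3) obtain Y where Y: "Y \<in> \<Y>" "sat_within n w Y"
    using expands_sat_within[of x \<Y> n w] by auto
  with expand assms(2) have "(\<Delta> \<union> Y, \<Gamma>) \<in> sequent_less"
    by (auto intro!: sequent_less_replace expands_weight)
  moreover have "sat_within n w (\<Delta> \<union> Y)" using Y(2) assms(3) expand(1) by simp
  ultimately show ?thesis using Y(1) expand(4)
    by (intro bexI[of _ "\<Delta> \<union> Y"] exI[of _ n] exI[of _ w]) auto
next
  case (load x \<Delta>)
  then have "sat M (unmark x) w" "sat_within n w \<Delta>" using assms(3) by auto
  then obtain m where "holds_within m w x" by (auto simp flip: ex_holds_within_iff)
  then have "sat_within (max m n) w (insert x \<Delta>)"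
    using \<open>sat_within n w \<Delta>\<close> by (auto intro: holds_within_mono[of m] sat_within_mono[of n])
  with load(2,3) show ?thesis by blast
next
  case (project a \<xi> \<Delta>)
  with assms(3) obtain m u where "m < n" "sat_within m u (insert (neg_xi \<xi>) (proj a \<Delta>))"
    using modal_sat_within by blast
  with project(2) show ?thesis by auto
qed

section \<open>Finitely many labels\<close>

primrec fl_step :: "('p, 'a) fml \<Rightarrow> ('p, 'a) fml set" where
  "fl_step Bot = {}"
| "fl_step (Prop p) = {}"
| "fl_step (Neg \<phi>) = {\<phi>}"
| "fl_step (Conj \<phi> \<psi>) = {\<phi>, \<psi>}"
| "fl_step (Box \<alpha> \<psi>) = {\<psi>} \<union> Tests \<alpha> \<union> {boxes \<delta>s \<psi> |Y \<delta>s. (Y, \<delta>s) \<in> Hset \<alpha>}"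

definition fl_closed_upto :: "('p, 'a) fml set \<Rightarrow> ('p, 'a) fml set \<Rightarrow> bool" where
  "fl_closed_upto B C \<longleftrightarrow> (\<forall>\<phi>\<in>C. fl_step \<phi> \<subseteq> B \<union> C)"

abbreviation fl_closed :: "('p, 'a) fml set \<Rightarrow> bool" where
  "fl_closed \<equiv> fl_closed_upto {}"

definition finitely_closable_upto ::
  "('p, 'a) fml set \<Rightarrow> ('p, 'a) fml set \<Rightarrow> bool" where
  "finitely_closable_upto B A \<longleftrightarrow> (\<exists>C. finite C \<and> A \<subseteq> C \<and> fl_closed_upto B C)"

lemma finitely_closable_upto_empty: "finitely_closable_upto B {}"
  unfolding finitely_closable_upto_def fl_closed_upto_def by blast

lemma finitely_closable_upto_subset:
  "finitely_closable_upto B A \<Longrightarrow> A' \<subseteq> A \<Longrightarrow> finitely_closable_upto B A'"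
  unfolding finitely_closable_upto_def by blast

lemma finitely_closable_upto_Un:
  assumes "finitely_closable_upto B\<^sub>1 A\<^sub>1" "finitely_closable_upto B\<^sub>2 A\<^sub>2" "B\<^sub>1 \<subseteq> B\<^sub>2 \<union> A\<^sub>2"
  shows "finitely_closable_upto B\<^sub>2 (A\<^sub>1 \<union> A\<^sub>2)"
proof -
  from assms(1) obtain C where C: "finite C" "A\<^sub>1 \<subseteq> C" "fl_closed_upto B\<^sub>1 C"
    by (auto simp: finitely_closable_upto_def)
  from assms(2) obtain D where D: "finite D" "A\<^sub>2 \<subseteq> D" "fl_closed_upto B\<^sub>2 D"
    by (auto simp: finitely_closable_upto_def)
  from C(3) D(2,3) assms(3) have "fl_closed_upto B\<^sub>2 (C \<union> D)"
    unfolding fl_closed_upto_def by blast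
  with C(1,2) D(1,2) show ?thesis
    unfolding finitely_closable_upto_def by (intro exI[of _ "C \<union> D"]) auto
qed

lemma finitely_closable_upto_step:
  assumes "finitely_closable_upto B' A" "B' \<subseteq> insert \<phi> B"
    and "fl_step \<phi> \<subseteq> insert \<phi> (B \<union> A \<union> (\<Union>\<chi>\<in>A. fl_step \<chi>))"
  shows "finitely_closable_upto B {\<phi>}"
proof -
  from assms(1) obtain C where C: "finite C" "A \<subseteq> C" "fl_closed_upto B' C"
    by (auto simp: finitely_closable_upto_def)
  from C(2,3) assms(2) have "(\<Union>\<chi>\<in>A. fl_step \<chi>) \<subseteq> insert \<phi> (B \<union> C)"
    unfolding fl_closed_upto_def by blast
  with C(2,3) assms(2,3) have "fl_closed_upto B (insert \<phi> C)"
    unfolding fl_closed_upto_def by blast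
  with C(1) show ?thesis by (auto simp: finitely_closable_upto_def)
qed

lemma fl_step_BoxI:
  "\<psi> \<in> fl_step (Box \<alpha> \<psi>)"
  "\<tau> \<in> Tests \<alpha> \<Longrightarrow> \<tau> \<in> fl_step (Box \<alpha> \<psi>)"
  "(Y, \<delta>s) \<in> Hset \<alpha> \<Longrightarrow> boxes \<delta>s \<psi> \<in> fl_step (Box \<alpha> \<psi>)"
  by auto

lemma fl_step_Box_Choice:
  "fl_step (Box (Choice \<alpha> \<beta>) \<psi>) = fl_step (Box \<alpha> \<psi>) \<union> fl_step (Box \<beta> \<psi>)"
  by auto

lemma fl_step_Box_Seq:
  "fl_step (Box (Seq \<alpha> \<beta>) \<psi>) \<subseteq> fl_step (Box \<alpha> (Box \<beta> \<psi>)) \<union> fl_step (Box \<beta> \<psi>)"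
  by (auto simp: boxes_snoc)

lemma fl_step_Box_Star:
  "fl_step (Box (Star \<alpha>) \<psi>) \<subseteq> {\<psi>} \<union> fl_step (Box \<alpha> (Box (Star \<alpha>) \<psi>))"
proof
  fix \<chi>
  assume "\<chi> \<in> fl_step (Box (Star \<alpha>) \<psi>)"
  then consider "\<chi> = \<psi>" | "\<chi> \<in> Tests \<alpha>"
    | Y \<delta>s where "(Y, \<delta>s) \<in> Hset \<alpha>" "\<chi> = boxes \<delta>s (Box (Star \<alpha>) \<psi>)"
    by (auto simp: boxes_snoc)
  then show "\<chi> \<in> {\<psi>} \<union> fl_step (Box \<alpha> (Box (Star \<alpha>) \<psi>))"
    by cases (auto intro: fl_step_BoxI simp del: fl_step.simps)
qed

text \<open>
  Closing \<open>[\<alpha>]\<psi>\<close> only up to \<open>\<psi>\<close> breaks the circularity in the case of \<open>\<alpha>\<^sup>*\<close>, where the closure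
  of \<open>[\<alpha>\<^sup>*]\<psi>\<close> needs that of \<open>[\<alpha>][\<alpha>\<^sup>*]\<psi>\<close>.
\<close>

lemma finitely_closable_fml_and_Box:
  fixes \<phi> :: "('p, 'a) fml" and \<alpha> :: "('p, 'a) prog"
  shows "finitely_closable_upto {} {\<phi>}" and "finitely_closable_upto {\<psi>} {Box \<alpha> \<psi>}"
proof (induction \<phi> and \<alpha> arbitrary: and \<psi>)
  case (Neg \<phi>)
  then show ?case by (rule finitely_closable_upto_step) auto
next
  case (Conj \<phi> \<psi>)
  from finitely_closable_upto_Un[OF this] have "finitely_closable_upto {} ({\<phi>} \<union> {\<psi>})" by simp
  then show ?case by (rule finitely_closable_upto_step) auto
next
  case (Box \<alpha> \<psi>)
  from finitely_closable_upto_Un[OF this] show ?case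
    by (rule finitely_closable_upto_subset) auto
next
  case (Test \<tau>)
  then show ?case by (rule finitely_closable_upto_step) auto
next
  case (Choice \<alpha> \<beta>)
  from finitely_closable_upto_Un[OF this]
  have "finitely_closable_upto {\<psi>} ({Box \<alpha> \<psi>} \<union> {Box \<beta> \<psi>})" by simp
  then show ?case
    by (rule finitely_closable_upto_step)
      (use fl_step_Box_Choice[of \<alpha> \<beta> \<psi>] in \<open>auto simp del: fl_step.simps\<close>)
next
  case (Seq \<alpha> \<beta>)
  from finitely_closable_upto_Un[OF this]
  have "finitely_closable_upto {\<psi>} ({Box \<alpha> (Box \<beta> \<psi>)} \<union> {Box \<beta> \<psi>})" by simp
  then show ?case
    by (rule finitely_closable_upto_step)
      (use fl_step_Box_Seq[of \<alpha> \<beta> \<psi>] in \<open>auto simp del: fl_step.simps\<close>)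
next
  case (Star \<alpha>)
  from Star[of "Box (Star \<alpha>) \<psi>"] show ?case
    by (rule finitely_closable_upto_step)
      (use fl_step_Box_Star[of \<alpha> \<psi>] in \<open>auto simp del: fl_step.simps\<close>)
qed (rule finitely_closable_upto_step[OF finitely_closable_upto_empty]; auto)+

lemma ex_finite_fl_closed_superset:
  assumes "finite A"
  shows "\<exists>C. finite C \<and> A \<subseteq> C \<and> fl_closed C"
proof -
  from assms have "finitely_closable_upto {} A"
  proof (induction A rule: finite_induct)
    case empty
    show ?case by (rule finitely_closable_upto_empty)
  next
    case (insert \<phi> A)
    from finitely_closable_upto_Un[OF finitely_closable_fml_and_Box(1)[of \<phi>] insert.IH]
    show ?case by simp
  qed
  then show ?thesis by (simp add: finitely_closable_upto_def)
qed

definition sequent_over :: "('p, 'a) fml set \<Rightarrow> ('p, 'a) sequent \<Rightarrow> bool" where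
  "sequent_over C \<Gamma> \<longleftrightarrow> unmark ` \<Gamma> \<subseteq> C \<union> Neg ` C"

lemma sequent_over_insert [simp]:
  "sequent_over C (insert x \<Gamma>) \<longleftrightarrow> unmark x \<in> C \<union> Neg ` C \<and> sequent_over C \<Gamma>"
  by (auto simp: sequent_over_def)

lemma sequent_over_Un [simp]:
  "sequent_over C (\<Gamma> \<union> \<Delta>) \<longleftrightarrow> sequent_over C \<Gamma> \<and> sequent_over C \<Delta>"
  by (auto simp: sequent_over_def)

lemma fl_closed_NegD:
  assumes "fl_closed C" "Neg \<phi> \<in> C \<union> Neg ` C"
  shows "\<phi> \<in> C"
  using assms by (fastforce simp: fl_closed_upto_def)

lemma fl_closed_stepD: "fl_closed C \<Longrightarrow> \<phi> \<in> C \<Longrightarrow> fl_step \<phi> \<subseteq> C"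
  by (simp add: fl_closed_upto_def)

lemma unfold_box_subset_fl_step:
  "\<Gamma> \<in> unfold_box \<alpha> \<psi> \<Longrightarrow> \<Gamma> \<subseteq> fl_step (Box \<alpha> \<psi>) \<union> Neg ` fl_step (Box \<alpha> \<psi>)"
  by (auto simp: unfold_box_def Xset_def Fset_def simp del: fl_step.simps
      dest!: Pset_imp_Hset intro: fl_step_BoxI)

lemma unfold_dia_subset_fl_step:
  "\<Gamma> \<in> unfold_dia \<alpha> \<psi> \<Longrightarrow> \<Gamma> \<subseteq> fl_step (Box \<alpha> \<psi>) \<union> Neg ` fl_step (Box \<alpha> \<psi>)"
  by (auto simp: unfold_dia_def simp del: fl_step.simps dest: Hset_subset_Tests intro: fl_step_BoxI)

lemma sequent_over_fl_step:
  assumes "fl_closed C" "\<phi> \<in> C" "unmark ` \<Gamma> \<subseteq> fl_step \<phi> \<union> Neg ` fl_step \<phi>"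
  shows "sequent_over C \<Gamma>"
  using assms(3) fl_closed_stepD[OF assms(1,2)] unfolding sequent_over_def by blast

lemma sequent_over_expands:
  assumes "expands x \<Y>" "Y \<in> \<Y>" "fl_closed C" "unmark x \<in> C \<union> Neg ` C"
  shows "sequent_over C Y"
  using assms(1)
proof cases
  case (Neg \<phi>)
  with assms(4) have "Neg \<phi> \<in> C" by (auto intro: fl_closed_NegD[OF assms(3)])
  with assms(3) show ?thesis by (rule sequent_over_fl_step) (use Neg assms(2) in simp)
next
  case (Conj \<phi> \<psi>)
  with assms(4) have "Conj \<phi> \<psi> \<in> C" by auto
  with assms(3) show ?thesis by (rule sequent_over_fl_step) (use Conj assms(2) in simp)
next
  case (NegConj \<phi> \<psi>)
  with assms(4) have "Conj \<phi> \<psi> \<in> C" by (intro fl_closed_NegD[OF assms(3)]) simp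
  with assms(3) show ?thesis by (rule sequent_over_fl_step) (use NegConj assms(2) in auto)
next
  case (Box \<alpha> \<phi>)
  with assms(4) have "Box \<alpha> \<phi> \<in> C" by auto
  moreover from Box assms(2) have "unmark ` Y \<in> unfold_box \<alpha> \<phi>" by (auto simp: image_image)
  ultimately show ?thesis
    by (rule sequent_over_fl_step[OF assms(3) _ unfold_box_subset_fl_step])
next
  case (Dia \<alpha> \<phi>)
  with assms(4) have "Box \<alpha> \<phi> \<in> C" by (intro fl_closed_NegD[OF assms(3)]) simp
  moreover from Dia assms(2) have "unmark ` Y \<in> unfold_dia \<alpha> \<phi>" by (auto simp: image_image)
  ultimately show ?thesis
    by (rule sequent_over_fl_step[OF assms(3) _ unfold_dia_subset_fl_step])
next
  case (LDia \<alpha> \<xi>)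
  with assms(4) have "Box \<alpha> (unmark_xi \<xi>) \<in> C" by (intro fl_closed_NegD[OF assms(3)]) simp
  moreover from LDia assms(2) have "unmark ` Y \<in> unfold_dia \<alpha> (unmark_xi \<xi>)"
    by (simp add: unmark_unfold_ldia)
  ultimately show ?thesis
    by (rule sequent_over_fl_step[OF assms(3) _ unfold_dia_subset_fl_step])
next
  case (LMinus \<alpha> \<xi>)
  with assms(2,4) show ?thesis by (simp add: sequent_over_def)
qed

lemma sequent_over_rule_inst:
  assumes "rule_inst r \<Gamma> D" "\<Gamma>' \<in> D" "fl_closed C" "sequent_over C \<Gamma>"
  shows "sequent_over C \<Gamma>'"
  using assms(1)
proof (cases rule: rule_inst_cases)
  case (expand x \<Delta> \<Y>)
  with assms(2,4) sequent_over_expands[OF expand(3) _ assms(3)] show ?thesis by auto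
next
  case (load x \<Delta>)
  with assms(2,4) show ?thesis by simp
next
  case (project a \<xi> \<Delta>)
  with assms(4) have "sequent_over C \<Delta>" "Box (Atom a) (unmark_xi \<xi>) \<in> C"
    by (simp, intro fl_closed_NegD[OF assms(3)]) simp_all
  moreover have "\<psi> \<in> C" if "Box (Atom a) \<psi> \<in> C" for \<psi>
    using fl_closed_stepD[OF assms(3) that] by simp
  ultimately have "unmark_xi \<xi> \<in> C" "sequent_over C (proj a \<Delta>)"
    by (auto simp: sequent_over_def proj_def)
  with project assms(2) show ?thesis by simp
qed

lemma unmark_xi_vimage_subset:
  "unmark_xi -` {\<phi>} \<subseteq>
     insert (Plain \<phi>) (case \<phi> of Box \<alpha> \<psi> \<Rightarrow> LBox \<alpha> ` (unmark_xi -` {\<psi>}) | _ \<Rightarrow> {})" (is "_ \<subseteq> ?R")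
proof
  fix \<xi>
  assume "\<xi> \<in> unmark_xi -` {\<phi>}"
  then show "\<xi> \<in> ?R" by (cases \<xi>) auto
qed

lemma finite_unmark_xi_vimage: "finite (unmark_xi -` {\<phi>})"
  by (induction \<phi> rule: fml.induct[of _ "\<lambda>_. True"])
    (simp_all add: finite_subset[OF unmark_xi_vimage_subset])

lemma finite_unmark_vimage: "finite (unmark -` {\<phi>})"
proof -
  have "unmark -` {\<phi>} \<subseteq>
      insert (Fml \<phi>) (case \<phi> of Neg \<psi> \<Rightarrow> neg_xi ` (unmark_xi -` {\<psi>}) | _ \<Rightarrow> {})" (is "_ \<subseteq> ?R")
  proof
    fix x
    assume "x \<in> unmark -` {\<phi>}"
    then consider (unmarked) "x = Fml \<phi>"
      | (marked) \<alpha> \<xi> where "x = neg_xi (LBox \<alpha> \<xi>)" "\<phi> = Neg (unmark_xi (LBox \<alpha> \<xi>))"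
      by (cases x) auto
    then show "x \<in> ?R"
    proof cases
      case marked
      then show ?thesis by (simp del: unmark_xi.simps neg_xi.simps)
    qed simp
  qed
  then show ?thesis
    by (rule finite_subset) (simp add: finite_unmark_xi_vimage split: fml.split)
qed

lemma finite_Collect_sequent_over:
  assumes "finite C"
  shows "finite {\<Gamma>. sequent_over C \<Gamma>}"
proof -
  have "finite (unmark -` (C \<union> Neg ` C))"
    using finite_finite_vimage_IntI[of "C \<union> Neg ` C" unmark UNIV] assms
    by (simp add: finite_unmark_vimage)
  moreover have "{\<Gamma>. sequent_over C \<Gamma>} = Pow (unmark -` (C \<union> Neg ` C))"
    unfolding sequent_over_def by blast
  ultimately show ?thesis by simp
qed

section \<open>Closed tableaux\<close>

lemma is_tableauD:
  assumes "is_tableau T"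
  shows "[] \<in> nodes T"
    and "t @ [i] \<in> nodes T \<Longrightarrow> t \<in> nodes T"
    and "t \<in> nodes T \<Longrightarrow> finite (label T t)"
    and "t \<in> nodes T \<Longrightarrow> \<not> leaf T t \<Longrightarrow> rule_inst (rule_at T t) (label T t) (label T ` children T t)"
  using assms unfolding is_tableau_def interior_def leaf_def by blast+

lemma nodes_prefix_closed:
  assumes "is_tableau T" "t \<in> nodes T" "prefix s t"
  shows "s \<in> nodes T"
  using assms(2,3)
proof (induction t rule: rev_induct)
  case (snoc i t)
  then have "t \<in> nodes T" using is_tableauD(2)[OF assms(1)] by blast
  with snoc show ?case by auto
qed simp

lemma strict_prefix_not_leaf:
  assumes "is_tableau T" "t \<in> nodes T" "strict_prefix s t"
  shows "\<not> leaf T s"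
proof -
  from assms(3) obtain i u where "t = (s @ [i]) @ u" by (auto elim: strict_prefixE')
  with nodes_prefix_closed[OF assms(1,2), of "s @ [i]"] show ?thesis
    by (auto simp: leaf_def children_def)
qed

lemma finite_labels:
  assumes "is_tableau T"
  shows "finite (label T ` nodes T)"
proof -
  have "finite (unmark ` label T [])" by (intro finite_imageI is_tableauD[OF assms])
  from ex_finite_fl_closed_superset[OF this] obtain C where
    C: "finite C" "unmark ` label T [] \<subseteq> C" "fl_closed C" by blast
  have "sequent_over C (label T t)" if "t \<in> nodes T" for t
    using that
  proof (induction t rule: rev_induct)
    case Nil
    show ?case using C(2) by (auto simp: sequent_over_def)
  next
    case (snoc i t)
    then have t: "t \<in> nodes T" using is_tableauD(2)[OF assms] by blast
    have child: "t @ [i] \<in> children T t" using snoc.prems by (simp add: children_def)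
    then have "\<not> leaf T t" by (auto simp: leaf_def)
    with is_tableauD(4)[OF assms t] child snoc.IH[OF t] show ?case
      by (blast intro: sequent_over_rule_inst[OF _ _ C(3)])
  qed
  then show ?thesis
    by (intro finite_subset[OF _ finite_Collect_sequent_over[OF C(1)]]) auto
qed

definition free_ancestor_labels :: "('p, 'a) tableau \<Rightarrow> nat list \<Rightarrow> ('p, 'a) sequent set" where
  "free_ancestor_labels T t = label T ` {s. strict_prefix s t \<and> free (label T s)}"

lemma free_ancestor_labels_snoc:
  "free_ancestor_labels T (t @ [i]) =
     (if free (label T t) then insert (label T t) else id) (free_ancestor_labels T t)"
proof -
  have "strict_prefix s (t @ [i]) \<longleftrightarrow> s = t \<or> strict_prefix s t" for s
    by (auto simp: strict_prefix_def)
  then have "{s. strict_prefix s (t @ [i]) \<and> free (label T s)} =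
      (if free (label T t) then insert t else id) {s. strict_prefix s t \<and> free (label T s)}"
    by auto
  then show ?thesis by (simp add: free_ancestor_labels_def)
qed

lemma free_ancestor_labels_loaded_path:
  assumes "prefix c t" "\<And>s. prefix c s \<Longrightarrow> prefix s t \<Longrightarrow> loaded (label T s)"
  shows "free_ancestor_labels T c = free_ancestor_labels T t"
proof -
  have "strict_prefix s c \<longleftrightarrow> strict_prefix s t" if "free (label T s)" for s
    using that assms prefix_same_cases[of s t c]
    by (auto simp: strict_prefix_def dest: prefix_order.trans prefix_order.antisym)
  then show ?thesis by (auto simp: free_ancestor_labels_def)
qed

lemma free_label_notin_free_ancestor_labels:
  assumes "pdl_tableau T" "t \<in> nodes T" "\<not> leaf T t" "free (label T t)"
  shows "label T t \<notin> free_ancestor_labels T t"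
proof
  assume "label T t \<in> free_ancestor_labels T t"
  with assms(2,4) have "free_repeat T t"
    by (auto simp: free_repeat_def repeat_def free_ancestor_labels_def)
  with assms(1,3) show False by (simp add: pdl_tableau_def)
qed

definition progress_measure ::
  "('p, 'a) tableau \<Rightarrow> nat list \<Rightarrow> nat \<Rightarrow> nat \<times> nat \<times> ('p, 'a) sequent" where
  "progress_measure T t n =
     (card (label T ` nodes T - free_ancestor_labels T t), n, label T t)"

abbreviation progress_order ::
  "((nat \<times> nat \<times> ('p, 'a) sequent) \<times> (nat \<times> nat \<times> ('p, 'a) sequent)) set" where
  "progress_order \<equiv> less_than <*lex*> less_than <*lex*> sequent_less"

lemma wf_progress_order: "wf progress_order"
  by (intro wf_lex_prod wf_less_than wf_sequent_less)

lemma progress_measure_below_free: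
  assumes "pdl_tableau T" "t @ [i] \<in> nodes T" "free (label T t)"
  shows "(progress_measure T (t @ [i]) m, progress_measure T t n) \<in> progress_order"
proof -
  have tab: "is_tableau T" using assms(1) by (simp add: pdl_tableau_def)
  then have t: "t \<in> nodes T" using assms(2) by (rule is_tableauD(2))
  have "\<not> leaf T t" using assms(2) by (auto simp: leaf_def children_def)
  with assms(1,3) t have "label T t \<notin> free_ancestor_labels T t"
    by (intro free_label_notin_free_ancestor_labels)
  then have "label T ` nodes T - insert (label T t) (free_ancestor_labels T t) \<subset>
      label T ` nodes T - free_ancestor_labels T t"
    using t by blast
  then have "card (label T ` nodes T - insert (label T t) (free_ancestor_labels T t)) <
      card (label T ` nodes T - free_ancestor_labels T t)"
    by (intro psubset_card_mono finite_Diff finite_labels[OF tab])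
  with assms(3) show ?thesis by (simp add: progress_measure_def free_ancestor_labels_snoc)
qed

lemma (in clocked_model) sat_within_child:
  assumes "pdl_tableau T" "t \<in> nodes T" "\<not> leaf T t" "sat_within n w (label T t)"
  shows "\<exists>s\<in>nodes T. \<exists>m v. sat_within m v (label T s) \<and>
    (progress_measure T s m, progress_measure T t n) \<in> progress_order"
proof -
  have tab: "is_tableau T" using assms(1) by (simp add: pdl_tableau_def)
  have "finite \<Gamma>" if "\<Gamma> \<in> label T ` children T t" for \<Gamma>
    using that is_tableauD(3)[OF tab] by (auto simp: children_def)
  from rule_inst_sat_within[OF is_tableauD(4)[OF tab assms(2,3)] this assms(4)]
  obtain i m v where child: "t @ [i] \<in> nodes T" "sat_within m v (label T (t @ [i]))"
    and less: "loaded (label T t) \<Longrightarrow>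
      ((m, label T (t @ [i])), (n, label T t)) \<in> less_than <*lex*> sequent_less"
    by (auto simp: children_def)
  have "(progress_measure T (t @ [i]) m, progress_measure T t n) \<in> progress_order"
  proof (cases "loaded (label T t)")
    case True
    with less show ?thesis by (simp add: progress_measure_def free_ancestor_labels_snoc)
  next
    case False
    with assms(1) child(1) show ?thesis by (rule progress_measure_below_free)
  qed
  with child show ?thesis by blast
qed

lemma (in clocked_model) sat_within_interior_copy:
  assumes "closed_pdl_tableau T" "t \<in> nodes T" "sat_within n w (label T t)"
  obtains c where "c \<in> nodes T" "\<not> leaf T c" "label T c = label T t"
    "progress_measure T c n = progress_measure T t n"
proof (cases "leaf T t")
  case True
  with assms(1,3) have "loaded_path_repeat T t"
    using closed_sequent_not_sat_within by (auto simp: closed_pdl_tableau_def)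
  then obtain c where c: "strict_prefix c t" "label T c = label T t"
    "\<And>s. prefix c s \<Longrightarrow> prefix s t \<Longrightarrow> loaded (label T s)"
    by (auto simp: loaded_path_repeat_def companion_def)
  have tab: "is_tableau T" using assms(1) by (simp add: closed_pdl_tableau_def pdl_tableau_def)
  show thesis
  proof
    show "c \<in> nodes T"
      using nodes_prefix_closed[OF tab assms(2)] c(1) by (simp add: strict_prefix_def)
    show "\<not> leaf T c" using tab assms(2) c(1) by (rule strict_prefix_not_leaf)
    show "label T c = label T t" by (fact c(2))
    have "free_ancestor_labels T c = free_ancestor_labels T t"
      using c(1,3) by (intro free_ancestor_labels_loaded_path) (auto simp: strict_prefix_def)
    with c(2) show "progress_measure T c n = progress_measure T t n"
      by (simp add: progress_measure_def)
  qed
next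
  case False
  with assms(2) that show thesis by blast
qed

theorem (in clocked_model) closed_pdl_tableau_not_sat_within:
  assumes "closed_pdl_tableau T"
  shows "t \<in> nodes T \<Longrightarrow> \<not> sat_within n w (label T t)"
proof (induction "progress_measure T t n" arbitrary: t n w
    rule: wf_induct_rule[OF wf_progress_order, case_names less])
  case (less t n w)
  have "pdl_tableau T" using assms by (simp add: closed_pdl_tableau_def)
  show ?case
  proof
    assume "sat_within n w (label T t)"
    with assms less.prems obtain c where c: "c \<in> nodes T" "\<not> leaf T c" "label T c = label T t"
      "progress_measure T c n = progress_measure T t n"
      by (rule sat_within_interior_copy)
    with \<open>pdl_tableau T\<close> \<open>sat_within n w (label T t)\<close> obtain s m v where
      "s \<in> nodes T" "sat_within m v (label T s)"
      "(progress_measure T s m, progress_measure T t n) \<in> progress_order"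
      using sat_within_child by metis
    with less.hyps show False by blast
  qed
qed

theorem theorem5p1:
  fixes T :: "('p, 'a) tableau" and t :: "nat list"
  assumes "closed_pdl_tableau T"
    and "t \<in> nodes T"
  shows "\<not> (\<exists>(M :: ('w, 'p, 'a) kripke) w. sat_sequent M w (label T t))"
proof
  assume "\<exists>(M :: ('w, 'p, 'a) kripke) w. sat_sequent M w (label T t)"
  then obtain M :: "('w, 'p, 'a) kripke" and w where "sat_sequent M w (label T t)" by blast
  then have sat: "sat_sequent (clock_product M) (w, 0) (label T t)"
    by (simp add: sat_sequent_def sat_clock_product)
  have "is_tableau T" using assms(1) by (simp add: closed_pdl_tableau_def pdl_tableau_def)
  then have "finite (label T t)" using assms(2) by (rule is_tableauD(3))
  interpret clocked_model "clock_product M" snd by (rule clocked_model_clock_product)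
  from \<open>finite (label T t)\<close> sat obtain n where "sat_within n (w, 0) (label T t)"
    by (rule sat_sequent_imp_sat_within)
  with closed_pdl_tableau_not_sat_within[OF assms] show False by blast
qed

end
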